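(* Let $u \in \mathbb K$ be the exact solution of the primal problem $$\frac{1}{2}\|\Lambda v\|_{\mathcal A}^2 - (f,v) \to \min_{v\in\mathbb K},$$ and let $p^* \in \widetilde Y^*$ be the exact solution of the dual problem $$-\frac12\|y^*\|_{\mathcal A^{-1}}^2 - \sup_{v\in\mathbb K}\bigl\{-(y^*,\Lambda v)+(f,v)\bigr\} \to \max_{y^*\in\widetilde Y^*},$$ where both solutions are assumed to exist and to be unique. Then for any function $v\in\mathbb K$ and any $y^*\in\widetilde Y^*$ the following equality holds: $$\frac12\|\Lambda(v-u)\|_{\mathcal A}^2+\frac12\|p^*-y^*\|_{\mathcal A^{-1}}^2+\bigl(\Lambda(v-u),\,p^*-y^*\bigr)=\frac12\|\mathcal A\Lambda v-y^*\|_{\mathcal A^{-1}}^2 .$$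
   Context: Setting. $\Omega\subset\mathbb R^n$ is a bounded domain with Lipschitz boundary. $V$ is a Sobolev space $H^k(\Omega)$ with some boundary conditions. $Y=Y(\Omega)$ is a space of scalar, vector or symmetric-matrix valued $L_2(\Omega)$-functions with the standard scalar product; its dual $Y^*$ is likewise a space of $L_2$-functions (identified with $Y$ via the $L_2$ scalar product). $\mathbb K\subseteq V$ is a nonempty convex closed subset. $f\in L_2(\Omega)$. Unindexed $(\cdot,\cdot)$ and $\|\cdot\|$ denote the standard $L_2$ scalar products and norms. Operator. $\Lambda: V\to Y$ is a bounded linear operator satisfying $\|\Lambda v\|_Y\ge \kappa\|v\|_V$ for all $v\in\mathbb K$, with a constant $\kappa>0$. Tensor. $\mathcal A$ is a tensor with elements in $L_\infty(\Omega)$ which provides a bounded linear self-adjoint mapping $Y\to Y$ and satisfies $\kappa_1\|\sigma\|_Y^2\le(\mathcal A\sigma,\sigma)_Y\le\kappa_2\|\sigma\|_Y^2$ for all $\sigma\in Y$, with positive constants $\kappa_1,\kappa_2$ independent of $\sigma$. $\mathcal A^{-1}$ is its inverse, a bounded linear self-adjoint mapping satisfying $\kappa_2^{-1}\|\sigma^*\|_{Y^*}^2\le(\mathcal A^{-1}\sigma^*,\sigma^* )_{Y^*}\le\kappa_1^{-1}\|\sigma^*\|_{Y^*}^2$ for all $\sigma^*\in Y^*$. The equivalent norms are $\|\gamma\|_{\mathcal A}=(\mathcal A\gamma,\gamma)_Y^{1/2}$ for $\gamma\in Y$ and $\|\gamma^*\|_{\mathcal A^{-1}}=(\mathcal A^{-1}\gamma^*,\gamma^*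 )_{Y^*}^{1/2}$ for $\gamma^*\in Y^*$. Dual admissible set. $\widetilde Y^*\subset Y^*$ is the set of all $y^*\in Y^*$ for which $\sup_{v\in\mathbb K}\{-(y^*,\Lambda v)+(f,v)\}\neq+\infty$. Relation between the solutions. When $u$ and $p^*$ exist and are unique, they are connected by $p^*=\mathcal A\Lambda u$. *)

theory Defs
  imports "HOL-Analysis.Analysis"
begin

text \<open>Bounded domains with Lipschitz boundary. After a rotation that makes \<open>e\<close> the last coordinate
  direction, \<open>\<Omega>\<close> is locally the strict epigraph of a Lipschitz function of the remaining ones;
  \<open>y - (y \<bullet> e) *\<^sub>R e\<close> is the projection of \<open>y\<close> to the hyperplane orthogonal to \<open>e\<close>.\<close>

definition lipschitz_boundary :: "(real^'n) set \<Rightarrow> bool" where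
  "lipschitz_boundary \<Omega> \<longleftrightarrow>
     (\<forall>x0\<in>frontier \<Omega>. \<exists>r>0. \<exists>e \<gamma> L. norm e = 1 \<and> L-lipschitz_on {y. y \<bullet> e = 0} \<gamma> \<and>
        \<Omega> \<inter> ball x0 r = {y \<in> ball x0 r. \<gamma> (y - (y \<bullet> e) *\<^sub>R e) < y \<bullet> e})"

definition bounded_lipschitz_domain :: "(real^'n) set \<Rightarrow> bool" where
  "bounded_lipschitz_domain \<Omega> \<longleftrightarrow>
     open \<Omega> \<and> connected \<Omega> \<and> \<Omega> \<noteq> {} \<and> bounded \<Omega> \<and> lipschitz_boundary \<Omega>"

text \<open>Elements of \<open>L\<^sub>2\<close> are represented by functions, and identities between them hold almost
  everywhere. The set \<open>S\<close> is a linear subspace of admissible values: \<open>UNIV\<close> for scalar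
  functions (\<open>'c = real\<close>) and vector functions (\<open>'c = real^'m\<close>), and the symmetric
  matrices for \<open>'c = real^'d^'d\<close>, whose inner product is the Frobenius one.\<close>

definition L2 :: "(real^'n) set \<Rightarrow> 'c::euclidean_space set \<Rightarrow> (real^'n \<Rightarrow> 'c) set" where
  "L2 \<Omega> S = {\<sigma>. \<sigma> \<in> borel_measurable (lebesgue_on \<Omega>) \<and>
      integrable (lebesgue_on \<Omega>) (\<lambda>x. (norm (\<sigma> x))\<^sup>2) \<and> (AE x in lebesgue_on \<Omega>. \<sigma> x \<in> S)}"

lemma subspace_symmetric_matrices: "subspace {M :: real^'d^'d. transpose M = M}"
  by (auto simp: subspace_def transpose_def vec_eq_iff)

definition ae_eq :: "(real^'n) set \<Rightarrow> (real^'n \<Rightarrow> 'c) \<Rightarrow> (real^'n \<Rightarrow> 'c) \<Rightarrow> bool" where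
  "ae_eq \<Omega> \<sigma> \<tau> \<longleftrightarrow> (AE x in lebesgue_on \<Omega>. \<sigma> x = \<tau> x)"

definition l2_inner :: "(real^'n) set \<Rightarrow> (real^'n \<Rightarrow> 'c::euclidean_space) \<Rightarrow> (real^'n \<Rightarrow> 'c) \<Rightarrow> real" where
  "l2_inner \<Omega> \<sigma> \<tau> = (LINT x|lebesgue_on \<Omega>. \<sigma> x \<bullet> \<tau> x)"

definition l2_norm :: "(real^'n) set \<Rightarrow> (real^'n \<Rightarrow> 'c::euclidean_space) \<Rightarrow> real" where
  "l2_norm \<Omega> \<sigma> = sqrt (l2_inner \<Omega> \<sigma> \<sigma>)"

text \<open>A list \<open>[i\<^sub>1, \<dots>, i\<^sub>j]\<close> of coordinates stands for the derivative
  \<open>\<partial>\<^sub>i\<^sub>1 \<dots> \<partial>\<^sub>i\<^sub>j\<close> of order \<open>j\<close>.\<close>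

primrec partials :: "'n list \<Rightarrow> (real^'n \<Rightarrow> real) \<Rightarrow> real^'n \<Rightarrow> real" where
  "partials [] \<phi> = \<phi>"
| "partials (i # l) \<phi> = (\<lambda>x. frechet_derivative (partials l \<phi>) (at x) (axis i 1))"

definition test_functions :: "(real^'n) set \<Rightarrow> (real^'n \<Rightarrow> real) set" where
  "test_functions \<Omega> = {\<phi>. (\<forall>l. partials l \<phi> differentiable_on UNIV) \<and>
      (\<exists>C. compact C \<and> C \<subseteq> \<Omega> \<and> (\<forall>x. x \<notin> C \<longrightarrow> \<phi> x = 0))}"

definition is_weak_partial ::
  "(real^'n) set \<Rightarrow> 'n list \<Rightarrow> (real^'n \<Rightarrow> 'b::euclidean_space) \<Rightarrow> (real^'n \<Rightarrow> 'b) \<Rightarrow> bool" where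
  "is_weak_partial \<Omega> l v g \<longleftrightarrow> g \<in> L2 \<Omega> UNIV \<and>
     (\<forall>\<phi>\<in>test_functions \<Omega>.
        (LINT x|lebesgue_on \<Omega>. partials l \<phi> x *\<^sub>R v x)
          = (-1) ^ length l *\<^sub>R (LINT x|lebesgue_on \<Omega>. \<phi> x *\<^sub>R g x))"

definition weak_partial ::
  "(real^'n) set \<Rightarrow> 'n list \<Rightarrow> (real^'n \<Rightarrow> 'b::euclidean_space) \<Rightarrow> real^'n \<Rightarrow> 'b" where
  "weak_partial \<Omega> l v = (SOME g. is_weak_partial \<Omega> l v g)"

definition sobolev :: "(real^'n) set \<Rightarrow> nat \<Rightarrow> (real^'n \<Rightarrow> 'b::euclidean_space) set" where
  "sobolev \<Omega> k = {v \<in> L2 \<Omega> UNIV. \<forall>l. length l \<le> k \<longrightarrow> (\<exists>g. is_weak_partial \<Omega> l v g)}"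

text \<open>Since weak derivatives commute, summing over lists of coordinates rather than over
  multi-indices only inserts multinomial weights: this is
  \<open>(\<Sum>j\<le>k. \<parallel>D\<^sup>j v\<parallel>\<^sup>2)\<^sup>1\<^sup>/\<^sup>2\<close> with the Frobenius norm of the
  derivative tensors \<open>D\<^sup>j v\<close>. The term of the empty list is \<open>\<parallel>v\<parallel>\<^sup>2\<close>.\<close>

definition sobolev_norm :: "(real^'n) set \<Rightarrow> nat \<Rightarrow> (real^'n \<Rightarrow> 'b::euclidean_space) \<Rightarrow> real" where
  "sobolev_norm \<Omega> k v = sqrt (\<Sum>l | length l \<le> k. (l2_norm \<Omega> (weak_partial \<Omega> l v))\<^sup>2)"

definition sobolev_closed_in ::
  "(real^'n) set \<Rightarrow> nat \<Rightarrow> (real^'n \<Rightarrow> 'b::euclidean_space) set \<Rightarrow> (real^'n \<Rightarrow> 'b) set \<Rightarrow> bool" where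
  "sobolev_closed_in \<Omega> k V K \<longleftrightarrow> K \<subseteq> V \<and>
     (\<forall>w v. (\<forall>i::nat. w i \<in> K) \<and> v \<in> V \<and>
        (\<lambda>i. sobolev_norm \<Omega> k (\<lambda>x. w i x - v x)) \<longlonglongrightarrow> 0 \<longrightarrow> v \<in> K)"

text \<open>\<open>H\<^sup>k(\<Omega>)\<close> with (unspecified, linear homogeneous) boundary conditions: a closed linear
  subspace of \<open>H\<^sup>k(\<Omega>)\<close> that contains all compactly supported smooth functions, that is,
  membership only restricts the traces on the boundary.\<close>

definition sobolev_with_bc ::
  "(real^'n) set \<Rightarrow> nat \<Rightarrow> (real^'n \<Rightarrow> 'b::euclidean_space) set \<Rightarrow> bool" where
  "sobolev_with_bc \<Omega> k V \<longleftrightarrow>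
     sobolev_closed_in \<Omega> k (sobolev \<Omega> k) V \<and>
     (\<forall>v\<in>V. \<forall>w\<in>V. (\<lambda>x. v x + w x) \<in> V) \<and>
     (\<forall>c. \<forall>v\<in>V. (\<lambda>x. c *\<^sub>R v x) \<in> V) \<and>
     (\<forall>\<phi>\<in>test_functions \<Omega>. \<forall>b. (\<lambda>x. \<phi> x *\<^sub>R b) \<in> V)"

definition convex_functions :: "(real^'n \<Rightarrow> 'b::euclidean_space) set \<Rightarrow> bool" where
  "convex_functions K \<longleftrightarrow>
     (\<forall>v\<in>K. \<forall>w\<in>K. \<forall>t\<in>{0..1}. (\<lambda>x. (1 - t) *\<^sub>R v x + t *\<^sub>R w x) \<in> K)"

text \<open>Bounded linear operators from a space \<open>X\<close> of functions with norm \<open>nrm\<close> to the space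
  \<open>L2 \<Omega> S\<close>. Linearity and boundedness together imply that \<open>T\<close> respects equality almost
  everywhere.\<close>

definition bounded_linear_L2 ::
  "(real^'n) set \<Rightarrow> (real^'n \<Rightarrow> 'b::euclidean_space) set \<Rightarrow> ((real^'n \<Rightarrow> 'b) \<Rightarrow> real) \<Rightarrow>
    'c::euclidean_space set \<Rightarrow> ((real^'n \<Rightarrow> 'b) \<Rightarrow> real^'n \<Rightarrow> 'c) \<Rightarrow> bool" where
  "bounded_linear_L2 \<Omega> X nrm S T \<longleftrightarrow>
     (\<forall>v\<in>X. T v \<in> L2 \<Omega> S) \<and>
     (\<forall>v\<in>X. \<forall>w\<in>X. ae_eq \<Omega> (T (\<lambda>x. v x + w x)) (\<lambda>x. T v x + T w x)) \<and>
     (\<forall>c. \<forall>v\<in>X. ae_eq \<Omega> (T (\<lambda>x. c *\<^sub>R v x)) (\<lambda>x. c *\<^sub>R T v x)) \<and>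
     (\<exists>C. \<forall>v\<in>X. l2_norm \<Omega> (T v) \<le> C * nrm v)"

definition selfadjoint_elliptic ::
  "(real^'n) set \<Rightarrow> 'c::euclidean_space set \<Rightarrow> ((real^'n \<Rightarrow> 'c) \<Rightarrow> real^'n \<Rightarrow> 'c) \<Rightarrow>
    real \<Rightarrow> real \<Rightarrow> bool" where
  "selfadjoint_elliptic \<Omega> S T c1 c2 \<longleftrightarrow>
     bounded_linear_L2 \<Omega> (L2 \<Omega> S) (l2_norm \<Omega>) S T \<and>
     (\<forall>\<sigma>\<in>L2 \<Omega> S. \<forall>\<tau>\<in>L2 \<Omega> S. l2_inner \<Omega> (T \<sigma>) \<tau> = l2_inner \<Omega> \<sigma> (T \<tau>)) \<and>
     (\<forall>\<sigma>\<in>L2 \<Omega> S. c1 * (l2_norm \<Omega> \<sigma>)\<^sup>2 \<le> l2_inner \<Omega> (T \<sigma>) \<sigma> \<and>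
        l2_inner \<Omega> (T \<sigma>) \<sigma> \<le> c2 * (l2_norm \<Omega> \<sigma>)\<^sup>2)"

definition Linfty_tensor ::
  "(real^'n) set \<Rightarrow> (real^'n \<Rightarrow> 'c::euclidean_space \<Rightarrow>\<^sub>L 'c) \<Rightarrow> bool" where
  "Linfty_tensor \<Omega> A \<longleftrightarrow>
     (\<forall>i\<in>Basis. \<forall>j\<in>Basis. (\<lambda>x. blinfun_apply (A x) i \<bullet> j) \<in> borel_measurable (lebesgue_on \<Omega>) \<and>
        (\<exists>M. AE x in lebesgue_on \<Omega>. \<bar>blinfun_apply (A x) i \<bullet> j\<bar> \<le> M))"

definition tensor_op ::
  "(real^'n \<Rightarrow> 'c::euclidean_space \<Rightarrow>\<^sub>L 'c) \<Rightarrow> (real^'n \<Rightarrow> 'c) \<Rightarrow> real^'n \<Rightarrow> 'c" where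
  "tensor_op A \<sigma> = (\<lambda>x. blinfun_apply (A x) (\<sigma> x))"

definition inverse_operators ::
  "(real^'n) set \<Rightarrow> 'c::euclidean_space set \<Rightarrow> ((real^'n \<Rightarrow> 'c) \<Rightarrow> real^'n \<Rightarrow> 'c) \<Rightarrow>
    ((real^'n \<Rightarrow> 'c) \<Rightarrow> real^'n \<Rightarrow> 'c) \<Rightarrow> bool" where
  "inverse_operators \<Omega> S T T' \<longleftrightarrow>
     (\<forall>\<sigma>\<in>L2 \<Omega> S. T \<sigma> \<in> L2 \<Omega> S \<and> T' \<sigma> \<in> L2 \<Omega> S \<and>
        ae_eq \<Omega> (T' (T \<sigma>)) \<sigma> \<and> ae_eq \<Omega> (T (T' \<sigma>)) \<sigma>)"

definition op_norm ::
  "(real^'n) set \<Rightarrow> ((real^'n \<Rightarrow> 'c::euclidean_space) \<Rightarrow> real^'n \<Rightarrow> 'c) \<Rightarrow> (real^'n \<Rightarrow> 'c) \<Rightarrow> real" where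
  "op_norm \<Omega> T \<gamma> = sqrt (l2_inner \<Omega> (T \<gamma>) \<gamma>)"

definition primal_functional ::
  "(real^'n) set \<Rightarrow> (real^'n \<Rightarrow> 'c::euclidean_space \<Rightarrow>\<^sub>L 'c) \<Rightarrow>
    ((real^'n \<Rightarrow> 'b::euclidean_space) \<Rightarrow> real^'n \<Rightarrow> 'c) \<Rightarrow> (real^'n \<Rightarrow> 'b) \<Rightarrow> (real^'n \<Rightarrow> 'b) \<Rightarrow> real" where
  "primal_functional \<Omega> A \<Lambda> f v = 1/2 * (op_norm \<Omega> (tensor_op A) (\<Lambda> v))\<^sup>2 - l2_inner \<Omega> f v"

definition constraint_sup ::
  "(real^'n) set \<Rightarrow> ((real^'n \<Rightarrow> 'b::euclidean_space) \<Rightarrow> real^'n \<Rightarrow> 'c::euclidean_space) \<Rightarrow>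
    (real^'n \<Rightarrow> 'b) \<Rightarrow> (real^'n \<Rightarrow> 'b) set \<Rightarrow> (real^'n \<Rightarrow> 'c) \<Rightarrow> ereal" where
  "constraint_sup \<Omega> \<Lambda> f K y = (SUP v\<in>K. ereal (- l2_inner \<Omega> y (\<Lambda> v) + l2_inner \<Omega> f v))"

text \<open>The dual of \<open>L2 \<Omega> S\<close> is identified with \<open>L2 \<Omega> S\<close> through the scalar product.\<close>

definition dual_admissible ::
  "(real^'n) set \<Rightarrow> 'c::euclidean_space set \<Rightarrow> ((real^'n \<Rightarrow> 'b::euclidean_space) \<Rightarrow> real^'n \<Rightarrow> 'c) \<Rightarrow>
    (real^'n \<Rightarrow> 'b) \<Rightarrow> (real^'n \<Rightarrow> 'b) set \<Rightarrow> (real^'n \<Rightarrow> 'c) set" where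
  "dual_admissible \<Omega> S \<Lambda> f K = {y \<in> L2 \<Omega> S. constraint_sup \<Omega> \<Lambda> f K y \<noteq> \<infinity>}"

definition dual_functional ::
  "(real^'n) set \<Rightarrow> ((real^'n \<Rightarrow> 'c::euclidean_space) \<Rightarrow> real^'n \<Rightarrow> 'c) \<Rightarrow>
    ((real^'n \<Rightarrow> 'b::euclidean_space) \<Rightarrow> real^'n \<Rightarrow> 'c) \<Rightarrow> (real^'n \<Rightarrow> 'b) \<Rightarrow> (real^'n \<Rightarrow> 'b) set \<Rightarrow>
    (real^'n \<Rightarrow> 'c) \<Rightarrow> ereal" where
  "dual_functional \<Omega> Ainv \<Lambda> f K y =
     ereal (- 1/2 * (op_norm \<Omega> Ainv y)\<^sup>2) - constraint_sup \<Omega> \<Lambda> f K y"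

end

theory Submission imports Defs begin

text \<open>The identity is an expansion of a square once \<open>p = \<A>\<Lambda>u\<close> almost everywhere is known.
  Write \<open>a = \<Lambda>v - \<Lambda>u\<close> and \<open>b = p - y\<close>. Then \<open>\<A>\<Lambda>v - y = \<A>a + b\<close>, and since \<open>\<A>\<inverse>\<close> is
  self-adjoint and inverts \<open>\<A>\<close>,
  \<open>(\<A>\<inverse>(\<A>a + b), \<A>a + b) = (\<A>a, a) + 2 (a, b) + (\<A>\<inverse>b, b)\<close>
  (lemma \<open>inverse_form_expansion\<close>); half of it is the claim.

  The relation \<open>p = \<A>\<Lambda>u\<close> comes from convex duality. Moving from \<open>u\<close> towards another point of
  the convex set \<open>K\<close> cannot decrease the primal energy, so \<open>u\<close> satisfies a variational inequality
  (lemma \<open>primal_variational_inequality\<close>). It says that for \<open>q = \<A>\<Lambda>u\<close> the supremum over \<open>K\<close>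
  in the dual functional is attained at \<open>u\<close>. Hence \<open>q\<close> is admissible, and its dual value is the
  minimal primal energy. The same expansion, applied to \<open>y - \<A>\<Lambda>u\<close>, gives
  \<open>(y, \<Lambda>u) \<le> 1/2 (\<A>\<inverse>y, y) + 1/2 (\<A>\<Lambda>u, \<Lambda>u)\<close>, whence no dual value exceeds the primal
  energy of \<open>u\<close> (lemma \<open>weak_duality\<close>). So \<open>q\<close> solves the dual problem
  (lemma \<open>flux_solves_dual\<close>), and uniqueness of the dual solution identifies it with \<open>p\<close>.\<close>

section \<open>The scalar product of square-integrable functions\<close>

lemma L2_measurable [measurable_dest]: "\<sigma> \<in> L2 \<Omega> S \<Longrightarrow> \<sigma> \<in> borel_measurable (lebesgue_on \<Omega>)"
  by (simp add: L2_def)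

lemma L2_inner_integrable:
  assumes "\<sigma> \<in> L2 \<Omega> S" "\<tau> \<in> L2 \<Omega> S'"
  shows "integrable (lebesgue_on \<Omega>) (\<lambda>x. \<sigma> x \<bullet> \<tau> x)"
proof (rule Bochner_Integration.integrable_bound)
  show "integrable (lebesgue_on \<Omega>) (\<lambda>x. (norm (\<sigma> x))\<^sup>2 + (norm (\<tau> x))\<^sup>2)"
    using assms by (auto simp: L2_def)
  show "(\<lambda>x. \<sigma> x \<bullet> \<tau> x) \<in> borel_measurable (lebesgue_on \<Omega>)"
    using assms by measurable
  have "\<bar>\<sigma> x \<bullet> \<tau> x\<bar> \<le> (norm (\<sigma> x))\<^sup>2 + (norm (\<tau> x))\<^sup>2" for x
  proof -
    have "\<bar>\<sigma> x \<bullet> \<tau> x\<bar> \<le> norm (\<sigma> x) * norm (\<tau> x)"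
      by (rule Cauchy_Schwarz_ineq2)
    also have "\<dots> \<le> 2 * norm (\<sigma> x) * norm (\<tau> x)"
      by simp
    also have "\<dots> \<le> (norm (\<sigma> x))\<^sup>2 + (norm (\<tau> x))\<^sup>2"
      by (rule sum_squares_bound)
    finally show ?thesis .
  qed
  then show "AE x in lebesgue_on \<Omega>. norm (\<sigma> x \<bullet> \<tau> x) \<le> norm ((norm (\<sigma> x))\<^sup>2 + (norm (\<tau> x))\<^sup>2)"
    by simp
qed

lemma L2_linear_combination:
  assumes "subspace S" "\<sigma> \<in> L2 \<Omega> S" "\<tau> \<in> L2 \<Omega> S"
  shows "(\<lambda>x. a *\<^sub>R \<sigma> x + b *\<^sub>R \<tau> x) \<in> L2 \<Omega> S"
proof -
  have "integrable (lebesgue_on \<Omega>)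
      (\<lambda>x. a\<^sup>2 * (\<sigma> x \<bullet> \<sigma> x) + 2 * a * b * (\<sigma> x \<bullet> \<tau> x) + b\<^sup>2 * (\<tau> x \<bullet> \<tau> x))"
    using assms by (intro Bochner_Integration.integrable_add integrable_mult_right)
      (auto intro: L2_inner_integrable)
  moreover have "(norm (a *\<^sub>R \<sigma> x + b *\<^sub>R \<tau> x))\<^sup>2
      = a\<^sup>2 * (\<sigma> x \<bullet> \<sigma> x) + 2 * a * b * (\<sigma> x \<bullet> \<tau> x) + b\<^sup>2 * (\<tau> x \<bullet> \<tau> x)" for x
    unfolding power2_norm_eq_inner
    by (simp add: inner_add_left inner_add_right inner_commute power2_eq_square algebra_simps)
  moreover have "AE x in lebesgue_on \<Omega>. a *\<^sub>R \<sigma> x + b *\<^sub>R \<tau> x \<in> S"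
  proof -
    have "AE x in lebesgue_on \<Omega>. \<sigma> x \<in> S" "AE x in lebesgue_on \<Omega>. \<tau> x \<in> S"
      using assms by (auto simp: L2_def)
    then show ?thesis
      by eventually_elim (simp add: assms(1) subspace_add subspace_scale)
  qed
  moreover have "(\<lambda>x. a *\<^sub>R \<sigma> x + b *\<^sub>R \<tau> x) \<in> borel_measurable (lebesgue_on \<Omega>)"
    using assms(2,3) by measurable
  ultimately show ?thesis
    by (simp add: L2_def)
qed

lemma L2_diff:
  assumes "subspace S" "\<sigma> \<in> L2 \<Omega> S" "\<tau> \<in> L2 \<Omega> S"
  shows "(\<lambda>x. \<sigma> x - \<tau> x) \<in> L2 \<Omega> S"
  using L2_linear_combination[OF assms, of 1 "-1"] by simp

lemma l2_inner_commute: "l2_inner \<Omega> \<sigma> \<tau> = l2_inner \<Omega> \<tau> \<sigma>"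
  by (simp add: l2_inner_def inner_commute)

lemma l2_inner_combination_left:
  assumes "\<sigma> \<in> L2 \<Omega> S" "\<tau> \<in> L2 \<Omega> S" "\<rho> \<in> L2 \<Omega> S'"
  shows "l2_inner \<Omega> (\<lambda>x. a *\<^sub>R \<sigma> x + b *\<^sub>R \<tau> x) \<rho> = a * l2_inner \<Omega> \<sigma> \<rho> + b * l2_inner \<Omega> \<tau> \<rho>"
  using assms by (simp add: l2_inner_def inner_add_left L2_inner_integrable[of _ _ _ _ S'])

lemma l2_inner_combination_right:
  assumes "\<sigma> \<in> L2 \<Omega> S" "\<tau> \<in> L2 \<Omega> S" "\<rho> \<in> L2 \<Omega> S'"
  shows "l2_inner \<Omega> \<rho> (\<lambda>x. a *\<^sub>R \<sigma> x + b *\<^sub>R \<tau> x) = a * l2_inner \<Omega> \<rho> \<sigma> + b * l2_inner \<Omega> \<rho> \<tau>"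
  using l2_inner_combination_left[OF assms] by (simp add: l2_inner_commute)

lemma l2_inner_cong_left:
  assumes "\<sigma> \<in> L2 \<Omega> S" "\<sigma>' \<in> L2 \<Omega> S" "\<tau> \<in> L2 \<Omega> S'" "ae_eq \<Omega> \<sigma> \<sigma>'"
  shows "l2_inner \<Omega> \<sigma> \<tau> = l2_inner \<Omega> \<sigma>' \<tau>"
  unfolding l2_inner_def
proof (rule integral_cong_AE)
  show "(\<lambda>x. \<sigma> x \<bullet> \<tau> x) \<in> borel_measurable (lebesgue_on \<Omega>)"
    using assms(1,3) by measurable
  show "(\<lambda>x. \<sigma>' x \<bullet> \<tau> x) \<in> borel_measurable (lebesgue_on \<Omega>)"
    using assms(2,3) by measurable
  show "AE x in lebesgue_on \<Omega>. \<sigma> x \<bullet> \<tau> x = \<sigma>' x \<bullet> \<tau> x"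
    using assms(4) unfolding ae_eq_def by eventually_elim simp
qed

lemma l2_inner_cong_right:
  assumes "\<sigma> \<in> L2 \<Omega> S" "\<sigma>' \<in> L2 \<Omega> S" "\<tau> \<in> L2 \<Omega> S'" "ae_eq \<Omega> \<sigma> \<sigma>'"
  shows "l2_inner \<Omega> \<tau> \<sigma> = l2_inner \<Omega> \<tau> \<sigma>'"
  using l2_inner_cong_left[OF assms] by (simp add: l2_inner_commute)

section \<open>Quadratic forms of self-adjoint operators\<close>

lemma bounded_linear_L2_in_L2:
  "bounded_linear_L2 \<Omega> X nrm S T \<Longrightarrow> v \<in> X \<Longrightarrow> T v \<in> L2 \<Omega> S"
  by (simp add: bounded_linear_L2_def)

lemma bounded_linear_L2_combination:
  assumes T: "bounded_linear_L2 \<Omega> X nrm S T"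
    and scale: "\<And>c v. v \<in> X \<Longrightarrow> (\<lambda>x. c *\<^sub>R v x) \<in> X"
    and X: "v \<in> X" "w \<in> X"
  shows "ae_eq \<Omega> (T (\<lambda>x. a *\<^sub>R v x + b *\<^sub>R w x)) (\<lambda>x. a *\<^sub>R T v x + b *\<^sub>R T w x)"
proof -
  have "ae_eq \<Omega> (T (\<lambda>x. v' x + w' x)) (\<lambda>x. T v' x + T w' x)" if "v' \<in> X" "w' \<in> X" for v' w'
    using T that unfolding bounded_linear_L2_def by blast
  from this[OF scale[OF X(1), of a] scale[OF X(2), of b]]
  have "ae_eq \<Omega> (T (\<lambda>x. a *\<^sub>R v x + b *\<^sub>R w x))
      (\<lambda>x. T (\<lambda>x. a *\<^sub>R v x) x + T (\<lambda>x. b *\<^sub>R w x) x)" .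
  moreover have "ae_eq \<Omega> (T (\<lambda>x. a *\<^sub>R v x)) (\<lambda>x. a *\<^sub>R T v x)"
    "ae_eq \<Omega> (T (\<lambda>x. b *\<^sub>R w x)) (\<lambda>x. b *\<^sub>R T w x)"
    using T X unfolding bounded_linear_L2_def by blast+
  ultimately show ?thesis
    unfolding ae_eq_def by eventually_elim simp
qed

lemma selfadjoint_elliptic_bounded_linear:
  "selfadjoint_elliptic \<Omega> S T c1 c2 \<Longrightarrow> bounded_linear_L2 \<Omega> (L2 \<Omega> S) (l2_norm \<Omega>) S T"
  by (simp add: selfadjoint_elliptic_def)

lemma selfadjoint_elliptic_symmetric:
  "selfadjoint_elliptic \<Omega> S T c1 c2 \<Longrightarrow> \<sigma> \<in> L2 \<Omega> S \<Longrightarrow> \<tau> \<in> L2 \<Omega> S \<Longrightarrow>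
    l2_inner \<Omega> (T \<sigma>) \<tau> = l2_inner \<Omega> \<sigma> (T \<tau>)"
  by (simp add: selfadjoint_elliptic_def)

lemma selfadjoint_elliptic_nonneg:
  assumes "selfadjoint_elliptic \<Omega> S T c1 c2" "c1 > 0" "\<sigma> \<in> L2 \<Omega> S"
  shows "l2_inner \<Omega> (T \<sigma>) \<sigma> \<ge> 0"
proof -
  have "0 \<le> c1 * (l2_norm \<Omega> \<sigma>)\<^sup>2"
    using assms(2) by simp
  also have "\<dots> \<le> l2_inner \<Omega> (T \<sigma>) \<sigma>"
    using assms(1,3) unfolding selfadjoint_elliptic_def by blast
  finally show ?thesis .
qed

lemma op_norm_squared:
  assumes "selfadjoint_elliptic \<Omega> S T c1 c2" "c1 > 0" "\<sigma> \<in> L2 \<Omega> S"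
  shows "(op_norm \<Omega> T \<sigma>)\<^sup>2 = l2_inner \<Omega> (T \<sigma>) \<sigma>"
  using selfadjoint_elliptic_nonneg[OF assms] by (simp add: op_norm_def)

text \<open>Elements of \<open>L\<^sub>2\<close> are functions, and \<open>T\<close> need not map functions that agree almost
  everywhere to the same function. Stating the expansion for any \<open>\<rho>\<close> that agrees almost everywhere
  with the linear combination makes it cover changes of representative as well: self-adjointness
  moves \<open>T\<close> to the other argument, where \<open>\<rho>\<close> may be replaced under the integral.\<close>

lemma quadratic_form_expansion:
  assumes S: "subspace S" and T: "selfadjoint_elliptic \<Omega> S T c1 c2"
    and L: "\<sigma> \<in> L2 \<Omega> S" "\<tau> \<in> L2 \<Omega> S" "\<rho> \<in> L2 \<Omega> S"
    and \<rho>: "ae_eq \<Omega> \<rho> (\<lambda>x. a *\<^sub>R \<sigma> x + b *\<^sub>R \<tau> x)"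
  shows "l2_inner \<Omega> (T \<rho>) \<rho>
    = a\<^sup>2 * l2_inner \<Omega> (T \<sigma>) \<sigma> + 2 * a * b * l2_inner \<Omega> (T \<sigma>) \<tau> + b\<^sup>2 * l2_inner \<Omega> (T \<tau>) \<tau>"
proof -
  note TL = bounded_linear_L2_in_L2[OF selfadjoint_elliptic_bounded_linear[OF T]]
  note sym = selfadjoint_elliptic_symmetric[OF T]
  have right: "l2_inner \<Omega> \<phi> \<rho> = a * l2_inner \<Omega> \<phi> \<sigma> + b * l2_inner \<Omega> \<phi> \<tau>" if "\<phi> \<in> L2 \<Omega> S" for \<phi>
    using l2_inner_cong_right[OF L(3) L2_linear_combination[OF S L(1,2)] that \<rho>]
      l2_inner_combination_right[OF L(1,2) that] by simp
  have left: "l2_inner \<Omega> (T \<rho>) \<phi> = a * l2_inner \<Omega> (T \<sigma>) \<phi> + b * l2_inner \<Omega> (T \<tau>) \<phi>"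
    if "\<phi> \<in> L2 \<Omega> S" for \<phi>
  proof -
    have move: "l2_inner \<Omega> (T \<phi>) \<psi> = l2_inner \<Omega> (T \<psi>) \<phi>" if "\<psi> \<in> L2 \<Omega> S" for \<psi>
      using sym[OF \<open>\<phi> \<in> L2 \<Omega> S\<close> that] by (simp add: l2_inner_commute)
    show ?thesis
      using right[OF TL[OF that]] by (simp add: move L)
  qed
  have "l2_inner \<Omega> (T \<tau>) \<sigma> = l2_inner \<Omega> (T \<sigma>) \<tau>"
    using sym[OF L(2,1)] by (simp add: l2_inner_commute)
  then show ?thesis
    by (simp add: right[OF TL[OF L(3)]] left[OF L(1)] left[OF L(2)] power2_eq_square algebra_simps)
qed

text \<open>With \<open>T'\<close> inverse to \<open>T\<close>, the form of \<open>T'\<close> at \<open>T \<sigma>\<close> is the form of \<open>T\<close> at \<open>\<sigma>\<close>, and the cross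
  term reduces to the plain scalar product. For the sign \<open>a = 1\<close> this is the error identity; for
  \<open>a = -1\<close> it is the Fenchel-Young inequality together with its exact defect.\<close>

lemma inverse_form_expansion:
  assumes S: "subspace S" and T: "selfadjoint_elliptic \<Omega> S T c1 c2"
    and T': "selfadjoint_elliptic \<Omega> S T' c1' c2'" and inv: "inverse_operators \<Omega> S T T'"
    and L: "\<sigma> \<in> L2 \<Omega> S" "\<tau> \<in> L2 \<Omega> S" "\<rho> \<in> L2 \<Omega> S"
    and \<rho>: "ae_eq \<Omega> \<rho> (\<lambda>x. a *\<^sub>R T \<sigma> x + \<tau> x)"
  shows "l2_inner \<Omega> (T' \<rho>) \<rho>
    = a\<^sup>2 * l2_inner \<Omega> (T \<sigma>) \<sigma> + 2 * a * l2_inner \<Omega> \<sigma> \<tau> + l2_inner \<Omega> (T' \<tau>) \<tau>"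
proof -
  have TL: "T \<sigma> \<in> L2 \<Omega> S"
    using bounded_linear_L2_in_L2[OF selfadjoint_elliptic_bounded_linear[OF T] L(1)] .
  have T'TL: "T' (T \<sigma>) \<in> L2 \<Omega> S"
    using bounded_linear_L2_in_L2[OF selfadjoint_elliptic_bounded_linear[OF T'] TL] .
  have cancel: "l2_inner \<Omega> (T' (T \<sigma>)) \<phi> = l2_inner \<Omega> \<sigma> \<phi>" if "\<phi> \<in> L2 \<Omega> S" for \<phi>
    using l2_inner_cong_left[OF T'TL L(1) that] inv L(1) by (simp add: inverse_operators_def)
  have "l2_inner \<Omega> (T' \<rho>) \<rho> = a\<^sup>2 * l2_inner \<Omega> (T' (T \<sigma>)) (T \<sigma>)
      + 2 * a * l2_inner \<Omega> (T' (T \<sigma>)) \<tau> + l2_inner \<Omega> (T' \<tau>) \<tau>"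
    using quadratic_form_expansion[OF S T' TL L(2,3), of a 1] \<rho> by simp
  then show ?thesis
    by (simp add: cancel[OF TL] cancel[OF L(2)] l2_inner_commute[of \<Omega> \<sigma> "T \<sigma>"])
qed

section \<open>Convex duality\<close>

lemma linear_coefficient_nonneg:
  fixes c e :: real
  assumes "\<And>t. 0 < t \<Longrightarrow> t \<le> 1 \<Longrightarrow> 0 \<le> t * c + t\<^sup>2 * e"
  shows "0 \<le> c"
proof (rule tendsto_lowerbound)
  show "((\<lambda>t. c + t * e) \<longlongrightarrow> c) (at_right 0)"
    by (auto intro!: tendsto_eq_intros)
  have "0 \<le> c + t * e" if "0 < t" "t \<le> 1" for t
  proof -
    have "0 \<le> t * (c + t * e)"
      using assms[OF that] by (simp add: power2_eq_square algebra_simps)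
    then show ?thesis
      using that(1) by (simp add: zero_le_mult_iff)
  qed
  then show "\<forall>\<^sub>F t in at_right 0. 0 \<le> c + t * e"
    by (auto simp: eventually_at_right_field intro!: exI[of _ 1])
qed simp

text \<open>The first-order optimality condition: the energy along the segment from \<open>u\<close> to \<open>w\<close> is a
  quadratic polynomial in the parameter, minimal at the endpoint \<open>u\<close>, so its slope there is
  nonnegative.\<close>

lemma primal_variational_inequality:
  assumes S: "subspace S" and A: "selfadjoint_elliptic \<Omega> S (tensor_op A) c1 c2" "c1 > 0"
    and \<Lambda>: "bounded_linear_L2 \<Omega> V nrm S \<Lambda>"
    and scale: "\<And>c v. v \<in> V \<Longrightarrow> (\<lambda>x. c *\<^sub>R v x) \<in> V"
    and V: "V \<subseteq> L2 \<Omega> UNIV" and K: "K \<subseteq> V" "convex_functions K"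
    and f: "f \<in> L2 \<Omega> UNIV"
    and u: "is_arg_min (primal_functional \<Omega> A \<Lambda> f) (\<lambda>w. w \<in> K) u"
    and w: "w \<in> K"
  shows "l2_inner \<Omega> f w - l2_inner \<Omega> f u
    \<le> l2_inner \<Omega> (tensor_op A (\<Lambda> u)) (\<Lambda> w) - l2_inner \<Omega> (tensor_op A (\<Lambda> u)) (\<Lambda> u)"
proof -
  let ?J = "primal_functional \<Omega> A \<Lambda> f" and ?T = "tensor_op A"
  let ?d = "\<lambda>x. \<Lambda> w x - \<Lambda> u x"
  have uK: "u \<in> K" and min: "?J u \<le> ?J w'" if "w' \<in> K" for w'
    using u that by (auto simp: is_arg_min_def not_less)
  have uV: "u \<in> V" and wV: "w \<in> V"
    using uK w K by auto
  note \<Lambda>L = bounded_linear_L2_in_L2[OF \<Lambda>]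
  have Lu: "\<Lambda> u \<in> L2 \<Omega> S" and Lw: "\<Lambda> w \<in> L2 \<Omega> S"
    using \<Lambda>L uV wV by auto
  have dL: "?d \<in> L2 \<Omega> S"
    using L2_diff[OF S Lw Lu] .
  have TuL: "?T (\<Lambda> u) \<in> L2 \<Omega> S"
    using bounded_linear_L2_in_L2[OF selfadjoint_elliptic_bounded_linear[OF A(1)] Lu] .
  have J: "?J w' = 1/2 * l2_inner \<Omega> (?T (\<Lambda> w')) (\<Lambda> w') - l2_inner \<Omega> f w'" if "w' \<in> V" for w'
    using op_norm_squared[OF A \<Lambda>L[OF that]] by (simp add: primal_functional_def)
  have "0 \<le> l2_inner \<Omega> (?T (\<Lambda> u)) ?d - (l2_inner \<Omega> f w - l2_inner \<Omega> f u)"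
  proof (rule linear_coefficient_nonneg)
    fix t :: real
    assume t: "0 < t" "t \<le> 1"
    let ?w = "\<lambda>x. (1 - t) *\<^sub>R u x + t *\<^sub>R w x"
    have wK: "?w \<in> K"
      using K(2) uK w t by (simp add: convex_functions_def)
    then have wV': "?w \<in> V"
      using K(1) by auto
    have "ae_eq \<Omega> (\<Lambda> ?w) (\<lambda>x. (1 - t) *\<^sub>R \<Lambda> u x + t *\<^sub>R \<Lambda> w x)"
      by (rule bounded_linear_L2_combination[OF \<Lambda> scale uV wV])
    then have "ae_eq \<Omega> (\<Lambda> ?w) (\<lambda>x. 1 *\<^sub>R \<Lambda> u x + t *\<^sub>R ?d x)"
      by (simp add: algebra_simps)
    then have "l2_inner \<Omega> (?T (\<Lambda> ?w)) (\<Lambda> ?w) = l2_inner \<Omega> (?T (\<Lambda> u)) (\<Lambda> u)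
        + 2 * t * l2_inner \<Omega> (?T (\<Lambda> u)) ?d + t\<^sup>2 * l2_inner \<Omega> (?T ?d) ?d"
      using quadratic_form_expansion[OF S A(1) Lu dL \<Lambda>L[OF wV'], of 1 t] by simp
    moreover have "l2_inner \<Omega> f ?w = (1 - t) * l2_inner \<Omega> f u + t * l2_inner \<Omega> f w"
      using V uV wV f by (intro l2_inner_combination_right) auto
    ultimately show "0 \<le> t * (l2_inner \<Omega> (?T (\<Lambda> u)) ?d - (l2_inner \<Omega> f w - l2_inner \<Omega> f u))
        + t\<^sup>2 * (1/2 * l2_inner \<Omega> (?T ?d) ?d)"
      using min[OF wK] J[OF uV] J[OF wV'] by (simp add: algebra_simps)
  qed
  moreover have "l2_inner \<Omega> (?T (\<Lambda> u)) ?d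
      = l2_inner \<Omega> (?T (\<Lambda> u)) (\<Lambda> w) - l2_inner \<Omega> (?T (\<Lambda> u)) (\<Lambda> u)"
    using l2_inner_combination_right[OF Lw Lu TuL, of 1 "-1"] by simp
  ultimately show ?thesis
    by simp
qed

text \<open>Testing the supremum with the single function \<open>w\<close> leaves \<open>(y, \<Lambda>w)\<close> to be bounded, and the
  bound is that \<open>\<A>\<inverse>\<close> has a nonnegative form at \<open>y - \<A>\<Lambda>w\<close>.\<close>

lemma weak_duality:
  assumes S: "subspace S" and A: "selfadjoint_elliptic \<Omega> S (tensor_op A) c1 c2" "c1 > 0"
    and A': "selfadjoint_elliptic \<Omega> S Ainv c1' c2'" "c1' > 0"
    and inv: "inverse_operators \<Omega> S (tensor_op A) Ainv"
    and w: "w \<in> K" "\<Lambda> w \<in> L2 \<Omega> S" and y: "y \<in> L2 \<Omega> S"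
  shows "dual_functional \<Omega> Ainv \<Lambda> f K y \<le> ereal (primal_functional \<Omega> A \<Lambda> f w)"
proof -
  let ?T = "tensor_op A"
  let ?r = "\<lambda>x. (-1) *\<^sub>R ?T (\<Lambda> w) x + y x"
  have TwL: "?T (\<Lambda> w) \<in> L2 \<Omega> S"
    using bounded_linear_L2_in_L2[OF selfadjoint_elliptic_bounded_linear[OF A(1)] w(2)] .
  have rL: "?r \<in> L2 \<Omega> S"
    using L2_linear_combination[OF S TwL y, of "-1" 1] by simp
  have "l2_inner \<Omega> (Ainv ?r) ?r
      = l2_inner \<Omega> (?T (\<Lambda> w)) (\<Lambda> w) - 2 * l2_inner \<Omega> (\<Lambda> w) y + l2_inner \<Omega> (Ainv y) y"
    using inverse_form_expansion[OF S A(1) A'(1) inv w(2) y rL, of "-1"] by (simp add: ae_eq_def)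
  then have young: "l2_inner \<Omega> y (\<Lambda> w)
      \<le> 1/2 * (op_norm \<Omega> ?T (\<Lambda> w))\<^sup>2 + 1/2 * (op_norm \<Omega> Ainv y)\<^sup>2"
    using selfadjoint_elliptic_nonneg[OF A' rL] op_norm_squared[OF A w(2)] op_norm_squared[OF A' y]
    by (simp add: l2_inner_commute)
  have "ereal (- l2_inner \<Omega> y (\<Lambda> w) + l2_inner \<Omega> f w) \<le> constraint_sup \<Omega> \<Lambda> f K y"
    unfolding constraint_sup_def using w(1) by (rule SUP_upper)
  then have "dual_functional \<Omega> Ainv \<Lambda> f K y
      \<le> ereal (- 1/2 * (op_norm \<Omega> Ainv y)\<^sup>2) - ereal (- l2_inner \<Omega> y (\<Lambda> w) + l2_inner \<Omega> f w)"
    unfolding dual_functional_def by (intro ereal_minus_mono order_refl)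
  also have "\<dots> \<le> ereal (primal_functional \<Omega> A \<Lambda> f w)"
    using young by (simp add: primal_functional_def)
  finally show ?thesis .
qed

text \<open>By the variational inequality the supremum for \<open>q = \<A>\<Lambda>u\<close> is attained at \<open>u\<close>, which makes the
  dual value of \<open>q\<close> equal to the primal energy of \<open>u\<close>, the upper bound from weak duality.\<close>

lemma flux_solves_dual:
  assumes S: "subspace S" and A: "selfadjoint_elliptic \<Omega> S (tensor_op A) c1 c2" "c1 > 0"
    and A': "selfadjoint_elliptic \<Omega> S Ainv c1' c2'" "c1' > 0"
    and inv: "inverse_operators \<Omega> S (tensor_op A) Ainv"
    and \<Lambda>: "bounded_linear_L2 \<Omega> V nrm S \<Lambda>"
    and scale: "\<And>c v. v \<in> V \<Longrightarrow> (\<lambda>x. c *\<^sub>R v x) \<in> V"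
    and V: "V \<subseteq> L2 \<Omega> UNIV" and K: "K \<subseteq> V" "convex_functions K"
    and f: "f \<in> L2 \<Omega> UNIV"
    and u: "is_arg_min (primal_functional \<Omega> A \<Lambda> f) (\<lambda>w. w \<in> K) u"
  shows "is_arg_max (dual_functional \<Omega> Ainv \<Lambda> f K) (\<lambda>q. q \<in> dual_admissible \<Omega> S \<Lambda> f K)
    (tensor_op A (\<Lambda> u))"
proof -
  let ?q = "tensor_op A (\<Lambda> u)"
  have uK: "u \<in> K"
    using u by (simp add: is_arg_min_def)
  have Lu: "\<Lambda> u \<in> L2 \<Omega> S"
    using bounded_linear_L2_in_L2[OF \<Lambda>] uK K(1) by auto
  have qL: "?q \<in> L2 \<Omega> S"
    using bounded_linear_L2_in_L2[OF selfadjoint_elliptic_bounded_linear[OF A(1)] Lu] .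
  have sup: "constraint_sup \<Omega> \<Lambda> f K ?q = ereal (- l2_inner \<Omega> ?q (\<Lambda> u) + l2_inner \<Omega> f u)"
    unfolding constraint_sup_def
  proof (rule antisym)
    show "(SUP w\<in>K. ereal (- l2_inner \<Omega> ?q (\<Lambda> w) + l2_inner \<Omega> f w))
        \<le> ereal (- l2_inner \<Omega> ?q (\<Lambda> u) + l2_inner \<Omega> f u)"
    proof (rule SUP_least)
      fix w
      assume "w \<in> K"
      from primal_variational_inequality[OF S A \<Lambda> scale V K f u this]
      show "ereal (- l2_inner \<Omega> ?q (\<Lambda> w) + l2_inner \<Omega> f w)
          \<le> ereal (- l2_inner \<Omega> ?q (\<Lambda> u) + l2_inner \<Omega> f u)"
        by simp
    qed
    show "ereal (- l2_inner \<Omega> ?q (\<Lambda> u) + l2_inner \<Omega> f u)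
        \<le> (SUP w\<in>K. ereal (- l2_inner \<Omega> ?q (\<Lambda> w) + l2_inner \<Omega> f w))"
      using uK by (rule SUP_upper)
  qed
  have adm: "?q \<in> dual_admissible \<Omega> S \<Lambda> f K"
    using qL sup by (simp add: dual_admissible_def)
  have "l2_inner \<Omega> (Ainv ?q) ?q = l2_inner \<Omega> ?q (\<Lambda> u)"
  proof -
    have "Ainv ?q \<in> L2 \<Omega> S" "ae_eq \<Omega> (Ainv ?q) (\<Lambda> u)"
      using inv Lu qL by (auto simp: inverse_operators_def)
    then show ?thesis
      using l2_inner_cong_left[OF _ Lu qL] l2_inner_commute[of \<Omega> "\<Lambda> u" ?q] by simp
  qed
  then have "dual_functional \<Omega> Ainv \<Lambda> f K ?q = ereal (primal_functional \<Omega> A \<Lambda> f u)"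
    by (simp add: dual_functional_def primal_functional_def sup op_norm_squared[OF A Lu]
        op_norm_squared[OF A' qL])
  then show ?thesis
    using adm weak_duality[where \<Lambda> = \<Lambda> and w = u, OF S A A' inv uK Lu]
    by (auto simp: is_arg_max_def not_less dual_admissible_def)
qed

section \<open>The error identity\<close>

theorem lemma1:
  fixes \<Omega> :: "(real^'n) set"
    and k :: nat
    and V K :: "(real^'n \<Rightarrow> 'b::euclidean_space) set"
    and S :: "'c::euclidean_space set"
    and \<Lambda> :: "(real^'n \<Rightarrow> 'b) \<Rightarrow> (real^'n \<Rightarrow> 'c)"
    and A :: "real^'n \<Rightarrow> 'c \<Rightarrow>\<^sub>L 'c"
    and Ainv :: "(real^'n \<Rightarrow> 'c) \<Rightarrow> (real^'n \<Rightarrow> 'c)"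
    and f u v :: "real^'n \<Rightarrow> 'b"
    and p y :: "real^'n \<Rightarrow> 'c"
    and \<kappa> \<kappa>1 \<kappa>2 :: real
  assumes "bounded_lipschitz_domain \<Omega>"
    and "sobolev_with_bc \<Omega> k V"
    and "subspace S"
    and "K \<noteq> {}" and "convex_functions K" and "sobolev_closed_in \<Omega> k V K"
    and "f \<in> L2 \<Omega> UNIV"
    and "bounded_linear_L2 \<Omega> V (sobolev_norm \<Omega> k) S \<Lambda>"
    and "\<kappa> > 0" and "\<forall>w\<in>K. l2_norm \<Omega> (\<Lambda> w) \<ge> \<kappa> * sobolev_norm \<Omega> k w"
    and "\<kappa>1 > 0" and "\<kappa>2 > 0"
    and "Linfty_tensor \<Omega> A"
    and "selfadjoint_elliptic \<Omega> S (tensor_op A) \<kappa>1 \<kappa>2"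
    and "inverse_operators \<Omega> S (tensor_op A) Ainv"
    and "selfadjoint_elliptic \<Omega> S Ainv (inverse \<kappa>2) (inverse \<kappa>1)"
    and "is_arg_min (primal_functional \<Omega> A \<Lambda> f) (\<lambda>w. w \<in> K) u"
    and "\<forall>u'. is_arg_min (primal_functional \<Omega> A \<Lambda> f) (\<lambda>w. w \<in> K) u' \<longrightarrow> ae_eq \<Omega> u' u"
    and "is_arg_max (dual_functional \<Omega> Ainv \<Lambda> f K) (\<lambda>q. q \<in> dual_admissible \<Omega> S \<Lambda> f K) p"
    and "\<forall>p'. is_arg_max (dual_functional \<Omega> Ainv \<Lambda> f K)
                (\<lambda>q. q \<in> dual_admissible \<Omega> S \<Lambda> f K) p' \<longrightarrow> ae_eq \<Omega> p' p"
    and "v \<in> K"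
    and "y \<in> dual_admissible \<Omega> S \<Lambda> f K"
  shows "1/2 * (op_norm \<Omega> (tensor_op A) (\<Lambda> (\<lambda>x. v x - u x)))\<^sup>2
           + 1/2 * (op_norm \<Omega> Ainv (\<lambda>x. p x - y x))\<^sup>2
           + l2_inner \<Omega> (\<Lambda> (\<lambda>x. v x - u x)) (\<lambda>x. p x - y x)
         = 1/2 * (op_norm \<Omega> Ainv (\<lambda>x. tensor_op A (\<Lambda> v) x - y x))\<^sup>2"
proof -
  note S = \<open>subspace S\<close> and \<Lambda> = \<open>bounded_linear_L2 \<Omega> V (sobolev_norm \<Omega> k) S \<Lambda>\<close>
  note A = \<open>selfadjoint_elliptic \<Omega> S (tensor_op A) \<kappa>1 \<kappa>2\<close> \<open>\<kappa>1 > 0\<close>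
  note A' = \<open>selfadjoint_elliptic \<Omega> S Ainv (inverse \<kappa>2) (inverse \<kappa>1)\<close>
    positive_imp_inverse_positive[OF \<open>\<kappa>2 > 0\<close>]
  note inv = \<open>inverse_operators \<Omega> S (tensor_op A) Ainv\<close>
  let ?T = "tensor_op A"
  let ?q = "?T (\<Lambda> u)" and ?a = "\<Lambda> (\<lambda>x. v x - u x)" and ?b = "\<lambda>x. p x - y x"
  have add: "(\<lambda>x. v' x + w x) \<in> V" if "v' \<in> V" "w \<in> V" for v' w
    using \<open>sobolev_with_bc \<Omega> k V\<close> that by (simp add: sobolev_with_bc_def)
  have scale: "(\<lambda>x. c *\<^sub>R w x) \<in> V" if "w \<in> V" for c w
    using \<open>sobolev_with_bc \<Omega> k V\<close> that by (simp add: sobolev_with_bc_def)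
  have V: "V \<subseteq> L2 \<Omega> UNIV"
    using \<open>sobolev_with_bc \<Omega> k V\<close>
    by (auto simp: sobolev_with_bc_def sobolev_closed_in_def sobolev_def)
  have K: "K \<subseteq> V"
    using \<open>sobolev_closed_in \<Omega> k V K\<close> by (simp add: sobolev_closed_in_def)
  have vV: "v \<in> V" and uV: "u \<in> V"
    using \<open>v \<in> K\<close> K \<open>is_arg_min (primal_functional \<Omega> A \<Lambda> f) (\<lambda>w. w \<in> K) u\<close>
    by (auto simp: is_arg_min_def)
  have dV: "(\<lambda>x. v x - u x) \<in> V"
    using add[OF vV scale[OF uV, of "-1"]] by simp
  note \<Lambda>L = bounded_linear_L2_in_L2[OF \<Lambda>]
  have TL: "?T \<sigma> \<in> L2 \<Omega> S" if "\<sigma> \<in> L2 \<Omega> S" for \<sigma>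
    using bounded_linear_L2_in_L2[OF selfadjoint_elliptic_bounded_linear[OF A(1)] that] .
  have pL: "p \<in> L2 \<Omega> S" and yL: "y \<in> L2 \<Omega> S"
    using \<open>is_arg_max (dual_functional \<Omega> Ainv \<Lambda> f K) (\<lambda>q. q \<in> dual_admissible \<Omega> S \<Lambda> f K) p\<close>
      \<open>y \<in> dual_admissible \<Omega> S \<Lambda> f K\<close>
    by (auto simp: is_arg_max_def dual_admissible_def)
  have bL: "?b \<in> L2 \<Omega> S" and rL: "(\<lambda>x. ?T (\<Lambda> v) x - y x) \<in> L2 \<Omega> S"
    using L2_diff[OF S] pL yL TL[OF \<Lambda>L[OF vV]] by auto
  have "ae_eq \<Omega> ?q p"
    using flux_solves_dual[OF S A A' inv \<Lambda> scale V K \<open>convex_functions K\<close> \<open>f \<in> L2 \<Omega> UNIV\<close>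
        \<open>is_arg_min (primal_functional \<Omega> A \<Lambda> f) (\<lambda>w. w \<in> K) u\<close>]
      \<open>\<forall>p'. is_arg_max (dual_functional \<Omega> Ainv \<Lambda> f K)
          (\<lambda>q. q \<in> dual_admissible \<Omega> S \<Lambda> f K) p' \<longrightarrow> ae_eq \<Omega> p' p\<close>
    by blast
  moreover have "ae_eq \<Omega> ?a (\<lambda>x. \<Lambda> v x - \<Lambda> u x)"
    using bounded_linear_L2_combination[OF \<Lambda> scale vV uV, of 1 "-1"] by simp
  ultimately have "ae_eq \<Omega> (\<lambda>x. ?T (\<Lambda> v) x - y x) (\<lambda>x. 1 *\<^sub>R ?T ?a x + ?b x)"
    unfolding ae_eq_def
  proof eventually_elim
    case (elim x)
    then show ?case
      by (simp add: tensor_op_def blinfun.diff_right)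
  qed
  from inverse_form_expansion[OF S A(1) A'(1) inv \<Lambda>L[OF dV] bL rL this]
  show ?thesis
    by (simp add: op_norm_squared[OF A \<Lambda>L[OF dV]] op_norm_squared[OF A' bL] op_norm_squared[OF A' rL])
qed

end
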